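(* Let $n, r, m$ be positive integers, and fix a matrix $M \in \mathbb{R}^{n\times n}$ with $\operatorname{rank}(M) = r$. Let $\mathcal{A}: \mathbb{R}^{n\times n} \to \mathbb{R}^m$ be a Gaussian operator with $m \geq 2nr - r^2 + 1$. Then, with probability $1$ (over the draw of $\mathcal{A}$), rank minimization recovers $M$; that is, with probability $1$, $M$ is the unique solution of $$\min_{X \in \mathbb{R}^{n\times n}} \operatorname{rank}(X) \quad \text{subject to} \quad \mathcal{A}(X) = \mathcal{A}(M).$$
   Context: The matrix inner product is $\langle A, B\rangle = \operatorname{trace}(A^* B)$. A linear operator $\mathcal{A}: \mathbb{R}^{n\times n} \to \mathbb{R}^m$ is given by matrices $A_1,\dots,A_m \in \mathbb{R}^{n\times n}$ via $(\mathcal{A}(X))_i = \langle A_i, X\rangle$ for $i = 1,\dots,m$. It is called a Gaussian operator if the random matrices $A_1,\dots,A_m$ are independent and each $A_i$ has i.i.d. Gaussian entries (nondegenerate, i.e. with positive variance). *)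

theory Defs
  imports "HOL-Probability.Probability"
begin

definition mat_inner :: "real^'n^'n \<Rightarrow> real^'n^'n \<Rightarrow> real" where
  "mat_inner A B = trace (transpose A ** B)"

definition lin_operator :: "('m \<Rightarrow> real^'n^'n) \<Rightarrow> real^'n^'n \<Rightarrow> real^'m" where
  "lin_operator A X = (\<chi> i. mat_inner (A i) X)"

(* Neither the mean nor the variance is normalised; only sigma > 0 is required. *)
definition iid_gaussian_entries :: "'w measure \<Rightarrow> ('w \<Rightarrow> real^'n^'n) \<Rightarrow> bool" where
  "iid_gaussian_entries P B \<longleftrightarrow>
     prob_space.indep_vars P (\<lambda>_. borel) (\<lambda>(j, k) \<omega>. B \<omega> $ j $ k) UNIV \<and>
     (\<exists>\<mu> \<sigma>. \<sigma> > 0 \<and>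
       (\<forall>j k. distributed P lborel (\<lambda>\<omega>. B \<omega> $ j $ k) (normal_density \<mu> \<sigma>)))"

(* The mean and variance of the entries may differ from one A i to another. *)
definition gaussian_operator :: "'w measure \<Rightarrow> ('m \<Rightarrow> 'w \<Rightarrow> real^'n^'n) \<Rightarrow> bool" where
  "gaussian_operator P A \<longleftrightarrow>
     prob_space.indep_vars P (\<lambda>_. borel) A UNIV \<and>
     (\<forall>i. iid_gaussian_entries P (A i))"

end

theory Submission
  imports Defs
begin

text \<open>The matrices of rank at most \<open>r\<close> are covered by finitely many polynomial images of
  \<open>2 n r - r\<^sup>2\<close> real parameters: choose \<open>r\<close> rows that span all rows, and express the others by
  their coefficients. If such an \<open>X \<noteq> M\<close> has the same measurements as \<open>M\<close>, then \<open>Z = X - M\<close> has a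
  nonzero entry \<open>(p, q)\<close>, and orthogonality of each \<open>A\<^sub>i\<close> to \<open>Z\<close> determines the entry \<open>(p, q)\<close> of
  \<open>A\<^sub>i\<close> from the other entries and \<open>X\<close>. So \<open>m\<close> entries of \<open>(A\<^sub>1, \<dots>, A\<^sub>m)\<close> are traded for fewer
  than \<open>m\<close> parameters, and the tuples that fail to single out \<open>M\<close> form a differentiable image of a
  null set. A Gaussian tuple has an absolutely continuous distribution, so it avoids this set.\<close>

section \<open>Absolute continuity of random vectors with independent components\<close>

text \<open>Both measures agree on boxes \<open>PiE I A\<close>: there the integrand splits into one
  factor per coordinate, and the integral of a product of such factors is the product of their
  integrals.\<close>

lemma PiM_density:
  assumes "finite I" "\<And>i. i \<in> I \<Longrightarrow> f i \<in> borel_measurable (M i)"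
    and "\<And>i. sigma_finite_measure (M i)" "\<And>i. sigma_finite_measure (density (M i) (f i))"
  shows "PiM I (\<lambda>i. density (M i) (f i)) = density (PiM I M) (\<lambda>x. \<Prod>i\<in>I. f i (x i))"
proof (rule sym, rule product_sigma_finite.PiM_eqI)
  interpret M: product_sigma_finite M
    using assms(3) by (simp add: product_sigma_finite_def)
  show "product_sigma_finite (\<lambda>i. density (M i) (f i))"
    using assms(4) by (simp add: product_sigma_finite_def)
  show "finite I" by fact
  show "sets (density (PiM I M) (\<lambda>x. \<Prod>i\<in>I. f i (x i))) = sets (PiM I (\<lambda>i. density (M i) (f i)))"
    by (simp cong: sets_PiM_cong)
  fix A assume A: "\<And>i. i \<in> I \<Longrightarrow> A i \<in> sets (density (M i) (f i))"
  have meas: "(\<lambda>x. \<Prod>i\<in>I. f i (x i)) \<in> borel_measurable (PiM I M)"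
    using assms(2) by (intro borel_measurable_prod_ennreal) (auto intro!: measurable_compose[OF measurable_component_singleton])
  have "emeasure (density (PiM I M) (\<lambda>x. \<Prod>i\<in>I. f i (x i))) (PiE I A)
      = (\<integral>\<^sup>+x. (\<Prod>i\<in>I. f i (x i)) * indicator (PiE I A) x \<partial>PiM I M)"
    using A assms(1) by (intro emeasure_density meas) (auto intro!: sets_PiM_I_finite)
  also have "\<dots> = (\<integral>\<^sup>+x. (\<Prod>i\<in>I. f i (x i) * indicator (A i) (x i)) \<partial>PiM I M)"
  proof (intro nn_integral_cong)
    fix x assume "x \<in> space (PiM I M)"
    then have "indicator (PiE I A) x = (\<Prod>i\<in>I. indicator (A i) (x i) :: ennreal)"
      using assms(1) by (auto simp: indicator_def space_PiM PiE_iff prod_zero_iff)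
    then show "(\<Prod>i\<in>I. f i (x i)) * indicator (PiE I A) x
        = (\<Prod>i\<in>I. f i (x i) * indicator (A i) (x i))"
      by (simp add: prod.distrib)
  qed
  also have "\<dots> = (\<Prod>i\<in>I. \<integral>\<^sup>+x. f i x * indicator (A i) x \<partial>M i)"
    using A assms by (intro M.product_nn_integral_prod borel_measurable_times_ennreal) auto
  also have "\<dots> = (\<Prod>i\<in>I. emeasure (density (M i) (f i)) (A i))"
    using A assms by (intro prod.cong) (auto simp: emeasure_density)
  finally show "emeasure (density (PiM I M) (\<lambda>x. \<Prod>i\<in>I. f i (x i))) (PiE I A)
      = (\<Prod>i\<in>I. emeasure (density (M i) (f i)) (A i))" .
qed

text \<open>By Radon-Nikodym each \<open>N i\<close> has a density with respect to
  \<open>M i\<close>, and the product of these is a density of the product measure.\<close>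

lemma absolutely_continuous_PiM:
  assumes "finite I" and "\<And>i. absolutely_continuous (M i) (N i)" "\<And>i. sets (N i) = sets (M i)"
    and M: "\<And>i. sigma_finite_measure (M i)" and N: "\<And>i. sigma_finite_measure (N i)"
  shows "absolutely_continuous (PiM I M) (PiM I N)"
proof -
  define f where "f i = RN_deriv (M i) (N i)" for i
  have f: "density (M i) (f i) = N i" for i
    unfolding f_def using assms by (intro sigma_finite_measure.density_RN_deriv)
  have "PiM I N = PiM I (\<lambda>i. density (M i) (f i))"
    by (simp add: f)
  also have "\<dots> = density (PiM I M) (\<lambda>x. \<Prod>i\<in>I. f i (x i))"
    using assms by (intro PiM_density) (auto simp: f, auto simp: f_def)
  finally have eq: "PiM I N = density (PiM I M) (\<lambda>x. \<Prod>i\<in>I. f i (x i))" .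
  have "(\<lambda>x. \<Prod>i\<in>I. f i (x i)) \<in> borel_measurable (PiM I M)"
    by (intro borel_measurable_prod_ennreal)
      (auto simp: f_def intro!: measurable_compose[OF measurable_component_singleton])
  then show ?thesis
    unfolding eq by (rule absolutely_continuousI_density)
qed

text \<open>Independence makes the joint law the product of the marginal laws. The map
  \<open>T\<close> repackages a family as one Euclidean vector; since it preserves Lebesgue measure,
  null sets pull back to null sets.\<close>

lemma (in prob_space) absolutely_continuous_distr_indep_vars:
  fixes X :: "'i::finite \<Rightarrow> 'a \<Rightarrow> 'b::euclidean_space"
  assumes indep: "indep_vars (\<lambda>_. borel) X UNIV"
    and ac: "\<And>i. absolutely_continuous lborel (distr M borel (X i))"
    and T: "T \<in> borel_measurable (PiM UNIV (\<lambda>_. lborel))"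
    and distr_T: "distr (PiM UNIV (\<lambda>_. lborel)) borel T = lborel"
  shows "absolutely_continuous lborel (distr M borel (\<lambda>\<omega>. T (\<lambda>i. X i \<omega>)))"
proof -
  have rv: "random_variable borel (X i)" for i
    using indep by (auto simp: indep_vars_def)
  have sets_eq: "sets (PiM UNIV (\<lambda>i::'i. distr M borel (X i))) = sets (PiM UNIV (\<lambda>_. lborel))"
    "sets (PiM UNIV (\<lambda>i::'i. borel :: 'b measure)) = sets (PiM UNIV (\<lambda>_. lborel))"
    by (auto intro!: sets_PiM_cong)
  have X: "(\<lambda>\<omega> i. X i \<omega>) \<in> measurable M (PiM UNIV (\<lambda>_. borel))"
    using measurable_restrict[where I = UNIV and X = X, OF rv] by (simp add: restrict_def)
  have T': "T \<in> borel_measurable (PiM UNIV (\<lambda>_. borel))"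
    using T measurable_cong_sets[OF sets_eq(2) refl] by auto
  have PiM: "distr M (PiM UNIV (\<lambda>_. borel)) (\<lambda>\<omega> i. X i \<omega>) = PiM UNIV (\<lambda>i. distr M borel (X i))"
    using indep_vars_iff_distr_eq_PiM[where I = UNIV and X = X and M' = "\<lambda>_. borel"] indep rv
    by (simp add: restrict_def)
  have ac_PiM: "absolutely_continuous (PiM UNIV (\<lambda>_. lborel)) (PiM UNIV (\<lambda>i. distr M borel (X i)))"
    using rv by (intro absolutely_continuous_PiM ac)
      (auto intro!: prob_space_imp_sigma_finite prob_space_distr sigma_finite_lborel)
  show ?thesis
    unfolding absolutely_continuous_def
  proof
    fix N :: "'c set" assume N: "N \<in> null_sets lborel"
    then have "N \<in> null_sets (distr (PiM UNIV (\<lambda>_. lborel)) borel T)"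
      by (simp add: distr_T)
    then have "T -` N \<inter> space (PiM UNIV (\<lambda>_. lborel)) \<in> null_sets (PiM UNIV (\<lambda>_. lborel))"
      using T by (subst (asm) null_sets_distr_iff) auto
    then have "T -` N \<in> null_sets (PiM UNIV (\<lambda>i. distr M borel (X i)))"
      using ac_PiM by (auto simp: absolutely_continuous_def space_PiM PiE_UNIV_domain)
    then have "T -` N \<in> null_sets (distr M (PiM UNIV (\<lambda>_. borel)) (\<lambda>\<omega> i. X i \<omega>))"
      by (simp add: PiM)
    then have "(\<lambda>\<omega> i. X i \<omega>) -` (T -` N) \<inter> space M \<in> null_sets M"
      using X by (subst (asm) null_sets_distr_iff) auto
    moreover have "(\<lambda>\<omega>. T (\<lambda>i. X i \<omega>)) \<in> borel_measurable M"
      using measurable_compose[OF X T'] .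
    ultimately show "N \<in> null_sets (distr M borel (\<lambda>\<omega>. T (\<lambda>i. X i \<omega>)))"
      using N by (subst null_sets_distr_iff) (auto simp: vimage_def null_sets_def)
  qed
qed

section \<open>Lebesgue measure on vectors and matrices as a product over the coordinates\<close>

lemma prod_Basis_vec:
  "(\<Prod>b\<in>(Basis :: ('a::euclidean_space ^ 'i) set). g b) = (\<Prod>i\<in>UNIV. \<Prod>b\<in>Basis. g (axis i b))"
proof -
  have "bij_betw (\<lambda>(i, b). axis i b) (UNIV \<times> Basis) (Basis :: ('a^'i) set)"
    by (auto simp: bij_betw_def inj_on_def axis_eq_axis Basis_vec_def)
  then show ?thesis
    by (subst prod.reindex_bij_betw[symmetric]) (auto simp: prod.cartesian_product split_def)
qed

lemma mem_box_vec:
  fixes x :: "'a::euclidean_space ^ 'i"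
  shows "x \<in> box l u \<longleftrightarrow> (\<forall>i. x $ i \<in> box (l $ i) (u $ i))"
  by (auto simp: mem_box Basis_vec_def inner_axis)

text \<open>Lebesgue measure is determined by its values on boxes. Here \<open>c l i\<close> is the
  \<open>i\<close>-th component of a corner \<open>l\<close>, so the preimage of a box is a product
  of boxes with the same total volume.\<close>

lemma distr_PiM_lborel_eqI:
  fixes T :: "('i::finite \<Rightarrow> 'a::euclidean_space) \<Rightarrow> 'b::euclidean_space"
  assumes T: "T \<in> borel_measurable (PiM UNIV (\<lambda>_. lborel))"
    and box: "\<And>l u f. T f \<in> box l u \<longleftrightarrow> (\<forall>i. f i \<in> box (c l i) (c u i))"
    and le: "\<And>l u i b. (\<And>b. b \<in> Basis \<Longrightarrow> l \<bullet> b \<le> u \<bullet> b) \<Longrightarrow> b \<in> Basis \<Longrightarrow> c l i \<bullet> b \<le> c u i \<bullet> b"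
    and prod: "\<And>l u. (\<Prod>b\<in>Basis. (u - l) \<bullet> b) = (\<Prod>i\<in>UNIV. \<Prod>b\<in>Basis. (c u i - c l i) \<bullet> b)"
  shows "distr (PiM UNIV (\<lambda>_. lborel)) borel T = lborel"
proof (rule lborel_eqI[symmetric])
  interpret product_sigma_finite "\<lambda>_::'i. lborel :: 'a measure"
    by standard
  fix l u :: 'b assume lu: "\<And>b. b \<in> Basis \<Longrightarrow> l \<bullet> b \<le> u \<bullet> b"
  have nonneg: "0 \<le> (\<Prod>b\<in>Basis. (c u i - c l i) \<bullet> b)" for i
    using le[OF lu] by (intro prod_nonneg) (auto simp: inner_diff_left)
  have "emeasure (distr (PiM UNIV (\<lambda>_. lborel)) borel T) (box l u)
      = emeasure (PiM UNIV (\<lambda>_. lborel)) (PiE UNIV (\<lambda>i. box (c l i) (c u i)))"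
    using T by (subst emeasure_distr)
      (auto simp: box space_PiM PiE_UNIV_domain Pi_iff intro!: arg_cong2[where f=emeasure])
  also have "\<dots> = (\<Prod>i\<in>UNIV. emeasure lborel (box (c l i) (c u i)))"
    by (intro emeasure_PiM) auto
  also have "\<dots> = (\<Prod>i\<in>UNIV. ennreal (\<Prod>b\<in>Basis. (c u i - c l i) \<bullet> b))"
    using le[OF lu] by (intro prod.cong) (auto simp: emeasure_lborel_box)
  also have "\<dots> = ennreal (\<Prod>b\<in>Basis. (u - l) \<bullet> b)"
    unfolding prod by (rule prod_ennreal) (rule nonneg)
  finally show "emeasure (distr (PiM UNIV (\<lambda>_. lborel)) borel T) (box l u)
      = ennreal (\<Prod>b\<in>Basis. (u - l) \<bullet> b)" .
qed simp

lemma borel_measurable_component_PiM_lborel: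
  "(\<lambda>f. f i) \<in> borel_measurable (PiM UNIV (\<lambda>_. lborel :: 'a::euclidean_space measure))"
  using measurable_component_singleton[of i UNIV "\<lambda>_. lborel :: 'a measure"]
  by (simp add: measurable_lborel1 cong: measurable_cong_sets)

lemma distr_PiM_lborel_vec:
  fixes T :: "('i::finite \<Rightarrow> 'a::euclidean_space) \<Rightarrow> 'a ^ 'i"
  defines "T \<equiv> (\<lambda>f. \<chi> i. f i)"
  shows "T \<in> borel_measurable (PiM UNIV (\<lambda>_. lborel))"
    and "distr (PiM UNIV (\<lambda>_. lborel)) borel T = lborel"
proof -
  show T: "T \<in> borel_measurable (PiM UNIV (\<lambda>_. lborel))"
    unfolding borel_measurable_euclidean_space[of T]
    by (auto simp: Basis_vec_def T_def inner_axis
        intro!: borel_measurable_inner borel_measurable_component_PiM_lborel)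
  show "distr (PiM UNIV (\<lambda>_. lborel)) borel T = lborel"
  proof (rule distr_PiM_lborel_eqI[OF T, where c = "\<lambda>l i. l $ i"])
    fix l u :: "'a ^ 'i" and i :: 'i and b :: 'a
    assume *: "\<And>b. b \<in> Basis \<Longrightarrow> l \<bullet> b \<le> u \<bullet> b" and b: "b \<in> Basis"
    show "l $ i \<bullet> b \<le> u $ i \<bullet> b"
      using *[of "axis i b"] b by (simp add: inner_axis)
  qed (auto simp: mem_box_vec T_def prod_Basis_vec inner_axis)
qed

lemma distr_PiM_lborel_matrix:
  fixes T :: "('m::finite \<times> 'n::finite \<Rightarrow> real) \<Rightarrow> real ^ 'n ^ 'm"
  defines "T \<equiv> (\<lambda>f. \<chi> j k. f (j, k))"
  shows "T \<in> borel_measurable (PiM UNIV (\<lambda>_. lborel))"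
    and "distr (PiM UNIV (\<lambda>_. lborel)) borel T = lborel"
proof -
  show T: "T \<in> borel_measurable (PiM UNIV (\<lambda>_. lborel))"
    unfolding borel_measurable_euclidean_space[of T]
    by (auto simp: Basis_vec_def T_def inner_axis intro!: borel_measurable_component_PiM_lborel)
  show "distr (PiM UNIV (\<lambda>_. lborel)) borel T = lborel"
  proof (rule distr_PiM_lborel_eqI[OF T, where c = "\<lambda>l (j, k). l $ j $ k"])
    fix l u :: "real ^ 'n ^ 'm" and i :: "'m \<times> 'n" and b :: real
    assume *: "\<And>b. b \<in> Basis \<Longrightarrow> l \<bullet> b \<le> u \<bullet> b" and b: "b \<in> Basis"
    obtain j k where i: "i = (j, k)" by fastforce
    show "(case i of (j, k) \<Rightarrow> l $ j $ k) \<bullet> b \<le> (case i of (j, k) \<Rightarrow> u $ j $ k) \<bullet> b"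
      using *[of "axis j (axis k 1)"] b by (simp add: i inner_axis)
  qed (auto simp: mem_box_vec T_def prod_Basis_vec inner_axis split_def prod.cartesian_product UNIV_Times_UNIV)
qed

text \<open>The independence argument is applied twice: from normally distributed entries to each
  matrix, then from the matrices to the tuple.\<close>

lemma absolutely_continuous_gaussian_operator:
  fixes A :: "'m::finite \<Rightarrow> 'w \<Rightarrow> real^'n^'n"
  assumes "prob_space P" and "gaussian_operator P A"
  shows "absolutely_continuous lborel (distr P borel (\<lambda>\<omega>. \<chi> i. A i \<omega>))"
proof -
  interpret prob_space P by fact
  have "absolutely_continuous lborel (distr P borel (A i))" for i
  proof -
    let ?X = "\<lambda>(j, k) \<omega>. A i \<omega> $ j $ k"
    from assms obtain \<mu> \<sigma> where
      indep: "indep_vars (\<lambda>_. borel) ?X UNIV" and "\<sigma> > 0" and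
      D: "\<And>j k. distributed P lborel (\<lambda>\<omega>. A i \<omega> $ j $ k) (normal_density \<mu> \<sigma>)"
      unfolding gaussian_operator_def iid_gaussian_entries_def by blast
    have "absolutely_continuous lborel (distr P borel (?X jk))" for jk
    proof -
      obtain j k where jk: "jk = (j, k)" by fastforce
      have "distr P borel (?X jk) = distr P lborel (\<lambda>\<omega>. A i \<omega> $ j $ k)"
        by (intro distr_cong) (auto simp: jk)
      also have "\<dots> = density lborel (normal_density \<mu> \<sigma>)"
        using D by (rule distributed_distr_eq_density)
      finally show ?thesis
        by (simp add: absolutely_continuousI_density)
    qed
    from absolutely_continuous_distr_indep_vars[OF indep this distr_PiM_lborel_matrix]
    show ?thesis by (simp add: vec_lambda_unique cong: distr_cong)
  qed
  moreover have "indep_vars (\<lambda>_. borel) A UNIV"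
    using assms by (simp add: gaussian_operator_def)
  ultimately show ?thesis
    using absolutely_continuous_distr_indep_vars[OF _ _ distr_PiM_lborel_vec] by blast
qed

section \<open>Matrices of bounded rank\<close>

lemma rank_le_imp_rows_combination:
  fixes X :: "real^'n^'m"
  assumes "rank X \<le> r" "r \<le> CARD('m)"
  obtains I C where "card I = r" "\<And>i. row i X = (\<Sum>i'\<in>I. C i i' *\<^sub>R row i' X)"
proof -
  obtain B where B: "B \<subseteq> rows X" "independent B" "rows X \<subseteq> span B" "card B = dim (rows X)"
    using basis_exists by blast
  have "finite (rows X)"
    by (simp add: rows_def full_SetCompr_eq)
  then have "finite B"
    using B(1) finite_subset by blast
  have "B \<subseteq> (\<lambda>i. row i X) ` UNIV"
    using B(1) by (auto simp: rows_def)
  then obtain J where J: "inj_on (\<lambda>i. row i X) J" "B = (\<lambda>i. row i X) ` J"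
    by (metis subset_image_inj)
  have "card J \<le> r"
    using B(4) J assms(1) by (simp add: card_image row_rank_def)
  \<comment> \<open>The basis indices are padded to exactly \<open>r\<close>, so that the later
    parameter count depends on \<open>r\<close> alone; the added rows get coefficient 0.\<close>
  with assms(2) obtain I where I: "J \<subseteq> I" "card I = r"
    using exists_subset_between[of J r UNIV] by auto
  have "\<exists>c. row i X = (\<Sum>i'\<in>I. c i' *\<^sub>R row i' X)" for i
  proof -
    have "row i X \<in> span B"
      using B(3) by (auto simp: rows_def)
    then obtain c where "row i X = (\<Sum>v\<in>B. c v *\<^sub>R v)"
      using \<open>finite B\<close> by (auto simp: span_finite)
    also have "\<dots> = (\<Sum>i'\<in>J. c (row i' X) *\<^sub>R row i' X)"
      using J by (simp add: sum.reindex)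
    also have "\<dots> = (\<Sum>i'\<in>I. (if i' \<in> J then c (row i' X) else 0) *\<^sub>R row i' X)"
      using I(1) by (intro sum.mono_neutral_cong_left) auto
    finally show ?thesis
      by (rule exI[of _ "\<lambda>i'. if i' \<in> J then c (row i' X) else 0"])
  qed
  with I(2) show ?thesis
    using that by metis
qed

text \<open>Rows in \<open>I\<close> are copied, the others are combinations of them whose coefficients sit in the
  columns indexed by \<open>I\<close>.\<close>

definition row_param :: "'n set \<Rightarrow> real^'n^'n \<Rightarrow> real^'n^'n" where
  "row_param I Y = (\<chi> i j. if i \<in> I then Y $ i $ j else \<Sum>i'\<in>I. Y $ i $ i' * Y $ i' $ j)"

definition row_param_support :: "'n set \<Rightarrow> ('n \<times> 'n) set" where
  "row_param_support I = I \<times> UNIV \<union> (- I) \<times> I"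

lemma row_param_cong:
  assumes "\<And>i j. (i, j) \<in> row_param_support I \<Longrightarrow> Y $ i $ j = Y' $ i $ j"
  shows "row_param I Y = row_param I Y'"
  using assms by (auto simp: row_param_def row_param_support_def vec_eq_iff intro!: sum.cong)

text \<open>With \<open>r = card I\<close> this is \<open>r n + (n - r) r\<close>, the dimension of
  the set of rank \<open>r\<close> matrices and the source of the bound on \<open>m\<close>.\<close>

lemma card_row_param_support:
  fixes I :: "'n::finite set"
  shows "int (card (row_param_support I)) = 2 * int CARD('n) * int (card I) - (int (card I))\<^sup>2"
proof -
  have "card (row_param_support I) = card I * CARD('n) + (CARD('n) - card I) * card I"
    unfolding row_param_support_def
    by (subst card_Un_disjoint) (auto simp: card_cartesian_product Compl_eq_Diff_UNIV card_Diff_subset)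
  moreover have "card I \<le> CARD('n)"
    by (simp add: card_mono)
  ultimately show ?thesis
    by (simp add: of_nat_diff int_distrib power2_eq_square left_diff_distrib)
qed

lemma rank_le_imp_row_param:
  fixes X :: "real^'n^'n"
  assumes "rank X \<le> r" "r \<le> CARD('n)"
  obtains I Y where "card I = r" "X = row_param I Y"
proof -
  obtain I C where I: "card I = r" and C: "\<And>i. row i X = (\<Sum>i'\<in>I. C i i' *\<^sub>R row i' X)"
    using rank_le_imp_rows_combination[OF assms] by blast
  \<comment> \<open>The rows in \<open>I\<close> hold those of \<open>X\<close>, the other rows the
    coefficients; only the entries in \<open>row_param_support I\<close> matter.\<close>
  define Y where "Y = (\<chi> i j. if i \<in> I then X $ i $ j else C i j)"
  have "row_param I Y $ i $ j = X $ i $ j" for i j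
  proof (cases "i \<in> I")
    case True
    then show ?thesis
      by (simp add: row_param_def Y_def)
  next
    case False
    then have "row_param I Y $ i $ j = (\<Sum>i'\<in>I. C i i' * X $ i' $ j)"
      by (simp add: row_param_def Y_def)
    also have "\<dots> = X $ i $ j"
      using arg_cong[OF C[of i], of "\<lambda>v. v $ j"] by (simp add: row_def)
    finally show ?thesis .
  qed
  then have "X = row_param I Y"
    by (simp add: vec_eq_iff)
  with I show ?thesis
    using that by blast
qed

section \<open>Operators that fail to separate a matrix from the others of bounded rank\<close>

text \<open>Summing over index pairs allows a single entry to be split off.\<close>

lemma mat_inner_altdef: "mat_inner A X = (\<Sum>(j, k)\<in>UNIV. A $ j $ k * X $ j $ k)"
proof -
  have "mat_inner A X = (\<Sum>k\<in>UNIV. \<Sum>j\<in>UNIV. A $ j $ k * X $ j $ k)"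
    by (simp add: mat_inner_def trace_def matrix_matrix_mult_def transpose_def)
  also have "\<dots> = (\<Sum>j\<in>UNIV. \<Sum>k\<in>UNIV. A $ j $ k * X $ j $ k)"
    by (rule sum.swap)
  finally show ?thesis
    by (simp add: sum.cartesian_product)
qed

lemma mat_inner_diff_right: "mat_inner A (X - Y) = mat_inner A X - mat_inner A Y"
  by (simp add: mat_inner_altdef split_def right_diff_distrib sum_subtractf)

lemma differentiable_vec_lambda:
  fixes f :: "'a::real_normed_vector \<Rightarrow> 'i::finite \<Rightarrow> 'b::euclidean_space"
  assumes "\<And>i. (\<lambda>x. f x i) differentiable (at a within S)"
  shows "(\<lambda>x. \<chi> i. f x i) differentiable (at a within S)"
  unfolding differentiable_componentwise_within[of "\<lambda>x. \<chi> i. f x i"]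
  using assms differentiable_componentwise_within
  by (auto simp: Basis_vec_def inner_axis)

text \<open>Solves \<open>mat_inner B Z = 0\<close> for the entry \<open>(p, q)\<close> of \<open>B\<close>.\<close>

definition solve_entry :: "'n \<Rightarrow> 'n \<Rightarrow> real^'n^'n \<Rightarrow> real^'n^'n \<Rightarrow> real^'n^'n" where
  "solve_entry p q Z B = (\<chi> j k. if (j, k) = (p, q)
     then - (\<Sum>(j, k)\<in>UNIV - {(p, q)}. B $ j $ k * Z $ j $ k) / Z $ p $ q else B $ j $ k)"

text \<open>The value of \<open>B'\<close> at \<open>(p, q)\<close> is overwritten by the one that
  orthogonality to \<open>Z\<close> forces, so this position is free to carry other data.\<close>

lemma solve_entry_eq:
  assumes "mat_inner B Z = 0" "Z $ p $ q \<noteq> 0"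
    and "\<And>j k. (j, k) \<noteq> (p, q) \<Longrightarrow> B' $ j $ k = B $ j $ k"
  shows "solve_entry p q Z B' = B"
proof -
  have "(\<Sum>(j, k)\<in>UNIV - {(p, q)}. B' $ j $ k * Z $ j $ k)
      = (\<Sum>(j, k)\<in>UNIV - {(p, q)}. B $ j $ k * Z $ j $ k)"
    by (intro sum.cong) (simp_all add: split_def assms(3) prod_eq_iff)
  also have "\<dots> = - (B $ p $ q * Z $ p $ q)"
    using assms(1) sum.remove[of UNIV "(p, q)" "\<lambda>(j, k). B $ j $ k * Z $ j $ k"]
    by (simp add: mat_inner_altdef)
  finally have eq: "(\<Sum>(j, k)\<in>UNIV - {(p, q)}. B' $ j $ k * Z $ j $ k) = - (B $ p $ q * Z $ p $ q)" .
  have "solve_entry p q Z B' $ j $ k = B $ j $ k" for j k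
  proof (cases "(j, k) = (p, q)")
    case True
    then show ?thesis
      using assms(2) by (simp add: solve_entry_def eq)
  next
    case False
    then show ?thesis
      using assms(3)[OF False] by (auto simp: solve_entry_def)
  qed
  then show ?thesis
    by (simp add: vec_eq_iff)
qed

text \<open>There are finitely many choices of \<open>I\<close>, \<open>p\<close> and
  \<open>q\<close>. For each of them a differentiable map of the tuple space into itself sends a
  negligible set onto a set containing the corresponding bad tuples.\<close>

lemma negligible_nonseparating:
  fixes M :: "real^'n^'n"
  assumes r: "r \<le> CARD('n)" and m: "int CARD('m::finite) \<ge> 2 * int CARD('n) * int r - (int r)\<^sup>2 + 1"
  shows "negligible {B :: real^'n^'n^'m. \<exists>X. X \<noteq> M \<and> rank X \<le> r \<and>
    (\<forall>i. mat_inner (B $ i) X = mat_inner (B $ i) M)}" (is "negligible ?E")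
proof -
  \<comment> \<open>The injection \<open>e\<close> assigns each parameter its own measurement index;
    the \<open>+ 1\<close> in the bound on \<open>m\<close> leaves at least one index over.\<close>
  have "\<exists>e. inj_on e (row_param_support I) \<and> e ` row_param_support I \<noteq> (UNIV :: 'm set)"
    if "card I = r" for I :: "'n set"
  proof -
    have lt: "card (row_param_support I) < CARD('m)"
      using card_row_param_support[of I] m unfolding that by linarith
    then obtain e :: "_ \<Rightarrow> 'm" where "inj_on e (row_param_support I)"
      using card_le_inj[of "row_param_support I" "UNIV :: 'm set"] by auto
    with lt show ?thesis
      by (metis card_image less_irrefl)
  qed
  then obtain e :: "'n set \<Rightarrow> 'n \<times> 'n \<Rightarrow> 'm" where
    inj: "\<And>I. card I = r \<Longrightarrow> inj_on (e I) (row_param_support I)" and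
    "\<And>I. card I = r \<Longrightarrow> e I ` row_param_support I \<noteq> UNIV"
    by metis
  then have "\<exists>i. card I = r \<longrightarrow> i \<notin> e I ` row_param_support I" for I
    by blast
  then obtain i0 where i0: "\<And>I. card I = r \<Longrightarrow> i0 I \<notin> e I ` row_param_support I"
    by metis
  \<comment> \<open>The \<open>m\<close> entries at position \<open>(p, q)\<close>, redundant because they are solved for, instead encode the
    parameters of \<open>X\<close>. As one of them stays unused, the domain lies in a hyperplane.\<close>
  define Z where "Z I p q B = row_param I (\<chi> i j. B $ e I (i, j) $ p $ q) - M"
    for I p q and B :: "real^'n^'n^'m"
  define f where "f I p q B = (\<chi> i. solve_entry p q (Z I p q B) (B $ i))"
    for I p q and B :: "real^'n^'n^'m"
  \<comment> \<open>Requiring \<open>Z I p q B $ p $ q\<close> to be nonzero makes the quotient in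
    \<open>solve_entry\<close> differentiable on \<open>S I p q\<close>.\<close>
  define S where "S I p q = {B. B $ i0 I $ p $ q = 0 \<and> Z I p q B $ p $ q \<noteq> 0}" for I p q
  have entry: "(\<lambda>B :: real^'n^'n^'m. B $ i $ j $ k) differentiable (at x within U)" for i j k x U
    by (intro bounded_linear_imp_differentiable bounded_linear_compose[OF bounded_linear_vec_nth]
        bounded_linear_vec_nth)
  have Z_diff: "(\<lambda>B. Z I p q B $ j $ k) differentiable (at x within U)" for I p q j k x U
    by (cases "j \<in> I")
      (auto simp: Z_def row_param_def intro!: entry differentiable_diff differentiable_sum differentiable_mult)
  have "negligible (f I p q ` S I p q)" for I p q
  proof (rule negligible_differentiable_image_negligible)
    have "negligible {B :: real^'n^'n^'m. B \<bullet> axis (i0 I) (axis p (axis q 1)) = 0}"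
      by (intro negligible_standard_hyperplane) auto
    then show "negligible (S I p q)"
      by (rule negligible_subset) (auto simp: S_def inner_axis)
    show "f I p q differentiable_on S I p q"
      unfolding differentiable_on_def f_def solve_entry_def split_def
    proof (intro ballI differentiable_vec_lambda)
      fix B i j k assume "B \<in> S I p q"
      then show "(\<lambda>B. if (j, k) = (p, q)
          then - (\<Sum>x\<in>UNIV - {(p, q)}. B $ i $ fst x $ snd x * Z I p q B $ fst x $ snd x) / Z I p q B $ p $ q
          else B $ i $ j $ k) differentiable at B within S I p q"
        by (cases "(j, k) = (p, q)")
          (auto simp: S_def intro!: entry Z_diff differentiable_minus differentiable_divide differentiable_sum differentiable_mult)
    qed
  qed simp
  then have "negligible (\<Union>(I, p, q)\<in>{I. card I = r} \<times> UNIV \<times> UNIV. f I p q ` S I p q)"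
    by (intro negligible_Union) auto
  moreover have "?E \<subseteq> (\<Union>(I, p, q)\<in>{I. card I = r} \<times> UNIV \<times> UNIV. f I p q ` S I p q)"
  proof
    fix B assume "B \<in> ?E"
    then obtain X where X: "X \<noteq> M" "rank X \<le> r" "\<And>i. mat_inner (B $ i) (X - M) = 0"
      by (auto simp: mat_inner_diff_right)
    obtain I Y where I: "card I = r" and Y: "X = row_param I Y"
      using rank_le_imp_row_param[OF X(2) r] by blast
    obtain p q where pq: "(X - M) $ p $ q \<noteq> 0"
      using X(1) by (auto simp: vec_eq_iff)
    \<comment> \<open>Inverting \<open>e I\<close> stores each parameter of \<open>Y\<close> at its
      index. The default 0 covers the spare index \<open>i0 I\<close>, which puts \<open>B'\<close>
      in the hyperplane.\<close>
    define y where "y i = (if i \<in> e I ` row_param_support I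
      then case inv_into (row_param_support I) (e I) i of (j, k) \<Rightarrow> Y $ j $ k else 0)" for i
    define B' where "B' = (\<chi> i j k. if (j, k) = (p, q) then y i else B $ i $ j $ k)"
    \<comment> \<open>Decoding \<open>B'\<close> returns \<open>Y\<close> on
      \<open>row_param_support I\<close>, which is all that \<open>row_param I\<close>
      reads.\<close>
    have "Z I p q B' = X - M"
      unfolding Z_def Y using inj[OF I]
      by (auto simp: B'_def y_def intro!: row_param_cong)
    moreover have "B' $ i0 I $ p $ q = 0"
      using i0[OF I] by (simp add: B'_def y_def)
    moreover have "solve_entry p q (X - M) (B' $ i) = B $ i" for i
      using X(3) pq by (rule solve_entry_eq) (auto simp: B'_def)
    ultimately have "B' \<in> S I p q" "f I p q B' = B"
      using pq by (simp_all add: S_def f_def)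
    with I show "B \<in> (\<Union>(I, p, q)\<in>{I. card I = r} \<times> UNIV \<times> UNIV. f I p q ` S I p q)"
      by force
  qed
  ultimately show ?thesis
    by (rule negligible_subset)
qed

theorem theorem2p2:
  fixes P :: "'w measure"
    and M :: "real^'n^'n"
    and A :: "'m::finite \<Rightarrow> 'w \<Rightarrow> real^'n^'n"
    and r :: nat
  assumes "prob_space P"
    and "r > 0"
    and "rank M = r"
    and "gaussian_operator P A"
    and "int CARD('m) \<ge> 2 * int CARD('n) * int r - (int r)^2 + 1"
  shows "AE \<omega> in P.
    {X. is_arg_min rank
          (\<lambda>X. lin_operator (\<lambda>i. A i \<omega>) X = lin_operator (\<lambda>i. A i \<omega>) M) X} = {M}"
proof -
  interpret prob_space P by fact
  let ?E = "{B :: real^'n^'n^'m. \<exists>X. X \<noteq> M \<and> rank X \<le> r \<and>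
    (\<forall>i. mat_inner (B $ i) X = mat_inner (B $ i) M)}"
  have "r \<le> CARD('n)"
    using rank_bound[of M] assms(3) by simp
  then have "?E \<in> null_sets lebesgue"
    using negligible_nonseparating assms(5) by (simp flip: negligible_iff_null_sets)
  \<comment> \<open>Negligibility makes \<open>?E\<close> a Lebesgue null set; a Borel null set
    covering it is what absolute continuity with respect to \<open>lborel\<close> can act
    on.\<close>
  then obtain N where N: "N \<in> null_sets lborel" "?E \<subseteq> N"
    by (auto simp: null_sets_completion_iff2)
  have rv: "random_variable borel (A i)" for i
    using assms(4) by (auto simp: gaussian_operator_def indep_vars_def)
  have vec: "(\<lambda>\<omega>. \<chi> i. A i \<omega>) \<in> borel_measurable P"
    unfolding borel_measurable_euclidean_space[of "\<lambda>\<omega>. \<chi> i. A i \<omega>"]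
  proof
    fix b :: "real^'n^'n^'m" assume "b \<in> Basis"
    then obtain i b' where "b = axis i b'"
      by (auto simp: Basis_vec_def[where 'a = "real^'n^'n"])
    then show "(\<lambda>\<omega>. (\<chi> i. A i \<omega>) \<bullet> b) \<in> borel_measurable P"
      using rv by (simp add: inner_axis)
  qed
  have "N \<in> null_sets (distr P borel (\<lambda>\<omega>. \<chi> i. A i \<omega>))"
    using absolutely_continuous_gaussian_operator[OF assms(1,4)] N(1)
    by (auto simp: absolutely_continuous_def)
  then have "(\<lambda>\<omega>. \<chi> i. A i \<omega>) -` N \<inter> space P \<in> null_sets P"
    using vec by (simp add: null_sets_distr_iff)
  then have "AE \<omega> in P. (\<chi> i. A i \<omega>) \<notin> N"
    by (rule AE_I') auto
  then show ?thesis
  proof eventually_elim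
    case (elim \<omega>)
    \<comment> \<open>Excluding every other feasible matrix of rank at most \<open>rank M\<close>
      gives both minimality of \<open>M\<close> and uniqueness.\<close>
    have "X = M" if "lin_operator (\<lambda>i. A i \<omega>) X = lin_operator (\<lambda>i. A i \<omega>) M" "rank X \<le> rank M" for X
    proof (rule ccontr)
      assume "X \<noteq> M"
      moreover have "mat_inner (A i \<omega>) X = mat_inner (A i \<omega>) M" for i
        using arg_cong[OF that(1), of "\<lambda>v. v $ i"] by (simp add: lin_operator_def)
      ultimately have "(\<chi> i. A i \<omega>) \<in> ?E"
        using that(2) assms(3) by auto
      with elim N(2) show False
        by blast
    qed
    then show ?case
      by (force simp: is_arg_min_def not_less)
  qed
qed

end
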